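(* Let $\eta>1$, $1<\beta<2$, let $f(x)=\sum_{i=1}^nf_i(x_i)$ with $f_i:\mathbb{R}\to\mathbb{R}$, and let $\{x^t\}_{t=0}^\infty$ be a sequence generated by the proximal diagonal Newton method (PDNM) without termination. Suppose that $f$ is $m$-strongly convex (with respect to the $\ell_2$ norm, $m>0$), $\nabla f$ and $\nabla^2f$ are Lipschitz continuous with constants $L_1$ and $L_2$, respectively, and $g$ is convex. Then $\{x^t\}_{t=0}^\infty$ converges to the unique minimizer $x^*$ of $F=f+g$. Furthermore, for all sufficiently large $t$, $k_t=0$ holds, and the sequence converges Q-quadratically, i.e. there is a constant $c\ge 0$ such that $\|x^{t+1}-x^*\|_2\le c\|x^t-x^*\|_2^2$ for all sufficiently large $t$.
   Context: Problem: minimize $F(x):=f(x)+g(x)$ over $x\in\mathbb{R}^n$, where $f:\mathbb{R}^n\to\mathbb{R}$ is twice continuously differentiable, $g:\mathbb{R}^n\to(-\infty,\infty]$ is proper, closed (lower semicontinuous) and directionally differentiable (for all $x\in\operatorname{dom}g$ and all $d$ with $x+\epsilon d\in\operatorname{dom} g$ for all sufficiently small $\epsilon>0$, the limit $g'(x;d)=\lim_{\epsilon\searrow0}(g(x+\epsilon d)-g(x))/\epsilon$ exists in $[-\infty,\infty]$), and $F$ is bounded below. Notation: for a square matrix $A$, $\operatorname{diag}(A)$ is the diagonal matrix with the same diagonal entries as $A$. For a positive definite matrix $A$, $\|x\|_A=\sqrt{x^\top Ax}$ and $\operatorname{prox}_g^A(x)=\operatorname{argmin}_y\{g(y)+\frac12\|y-x\|_A^2\}$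 (a set). Lipschitz continuity of $\nabla f$ is with respect to $\|\cdot\|_2$, and that of $\nabla^2f$ is with respect to the spectral operator norm on matrices and $\|\cdot\|_2$ on $\mathbb{R}^n$. PDNM with parameters $\eta>1$, $\beta>0$ and starting point $x^0\in\operatorname{dom}g$: at iteration $t=0,1,2,\dots$ put $D_t=\operatorname{diag}(\nabla^2f(x^t))$ (positive definite). For $k=0,1,2,\dots$ successively compute a trial point $x^{t,k}\in\operatorname{prox}_g^{\eta^kD_t}\bigl(x^t-(\eta^kD_t)^{-1}\nabla f(x^t)\bigr)$, and let $k_t$ be the first $k$ for which $$f(x^{t,k})\le f(x^t)+\nabla f(x^t)^\top(x^{t,k}-x^t)+\frac{\beta}{2}\|x^{t,k}-x^t\|_{\eta^kD_t}^2.$$ Set $x^{t+1}=x^{t,k_t}$. *)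

theory Defs
  imports "HOL-Analysis.Analysis"
begin

section \<open>Smooth functions on Euclidean space\<close>

definition gradient :: "(real^'n \<Rightarrow> real) \<Rightarrow> real^'n \<Rightarrow> real^'n" where
  "gradient f x = (THE D. GDERIV f x :> D)"

definition hessian :: "(real^'n \<Rightarrow> real) \<Rightarrow> real^'n \<Rightarrow> real^'n^'n" where
  "hessian f x = jacobian (gradient f) (at x)"

definition twice_continuously_differentiable :: "(real^'n \<Rightarrow> real) \<Rightarrow> bool" where
  "twice_continuously_differentiable f \<longleftrightarrow>
     (\<forall>x. f differentiable (at x)) \<and>
     (\<forall>x. gradient f differentiable (at x)) \<and>
     continuous_on UNIV (hessian f)"

definition strongly_convex :: "real \<Rightarrow> ('a::real_inner \<Rightarrow> real) \<Rightarrow> bool" where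
  "strongly_convex m f \<longleftrightarrow>
     (\<forall>x y. \<forall>u\<in>{0..1}.
        f (u *\<^sub>R x + (1 - u) *\<^sub>R y)
          \<le> u * f x + (1 - u) * f y - m / 2 * u * (1 - u) * (norm (x - y))\<^sup>2)"

text \<open>
  The norm that \<^typ>\<open>real^'n^'n\<close> carries as a normed space is the Frobenius norm, so
  Lipschitz continuity in the spectral norm is stated through \<^const>\<open>onorm\<close>.
\<close>

definition spectral_lipschitz :: "real \<Rightarrow> (real^'n \<Rightarrow> real^'n^'n) \<Rightarrow> bool" where
  "spectral_lipschitz L M \<longleftrightarrow>
     (\<forall>x y. onorm (\<lambda>v. (M x - M y) *v v) \<le> L * norm (x - y))"


section \<open>Extended-real-valued functions\<close>

definition eff_dom :: "('a \<Rightarrow> ereal) \<Rightarrow> 'a set" where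
  "eff_dom g = {x. g x < \<infinity>}"

definition epi :: "('a \<Rightarrow> ereal) \<Rightarrow> ('a \<times> real) set" where
  "epi g = {(x, r). g x \<le> ereal r}"

definition proper_fun :: "('a \<Rightarrow> ereal) \<Rightarrow> bool" where
  "proper_fun g \<longleftrightarrow> eff_dom g \<noteq> {} \<and> (\<forall>x. g x \<noteq> -\<infinity>)"

definition closed_fun :: "('a::topological_space \<Rightarrow> ereal) \<Rightarrow> bool" where
  "closed_fun g \<longleftrightarrow> closed (epi g)"

definition convex_fun :: "('a::real_vector \<Rightarrow> ereal) \<Rightarrow> bool" where
  "convex_fun g \<longleftrightarrow> convex (epi g)"

definition directionally_differentiable :: "('a::real_normed_vector \<Rightarrow> ereal) \<Rightarrow> bool" where
  "directionally_differentiable g \<longleftrightarrow>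
     (\<forall>x\<in>eff_dom g. \<forall>d.
        (\<forall>\<^sub>F \<epsilon> in at_right 0. x + \<epsilon> *\<^sub>R d \<in> eff_dom g) \<longrightarrow>
        (\<exists>l::ereal. ((\<lambda>\<epsilon>. (g (x + \<epsilon> *\<^sub>R d) - g x) / ereal \<epsilon>) \<longlongrightarrow> l) (at_right 0)))"


section \<open>The proximal diagonal Newton method\<close>

definition diag_part :: "real^'n^'n \<Rightarrow> real^'n^'n" where
  "diag_part A = (\<chi> i j. if i = j then A $ i $ j else 0)"

definition mnorm :: "real^'n^'n \<Rightarrow> real^'n \<Rightarrow> real" where
  "mnorm A x = sqrt (x \<bullet> (A *v x))"

definition prox :: "(real^'n \<Rightarrow> ereal) \<Rightarrow> real^'n^'n \<Rightarrow> real^'n \<Rightarrow> (real^'n) set" where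
  "prox g A x =
     {y. is_arg_min (\<lambda>z. g z + ereal (1/2 * (mnorm A (z - x))\<^sup>2)) (\<lambda>_. True) y}"

definition pdnm_metric :: "real \<Rightarrow> (real^'n \<Rightarrow> real) \<Rightarrow> real^'n \<Rightarrow> nat \<Rightarrow> real^'n^'n" where
  "pdnm_metric \<eta> f x k = \<eta> ^ k *\<^sub>R diag_part (hessian f x)"

definition pdnm_trial ::
    "real \<Rightarrow> (real^'n \<Rightarrow> real) \<Rightarrow> (real^'n \<Rightarrow> ereal) \<Rightarrow> real^'n \<Rightarrow> nat \<Rightarrow> (real^'n) set" where
  "pdnm_trial \<eta> f g x k =
     prox g (pdnm_metric \<eta> f x k)
       (x - matrix_inv (pdnm_metric \<eta> f x k) *v gradient f x)"

definition pdnm_accept ::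
    "real \<Rightarrow> real \<Rightarrow> (real^'n \<Rightarrow> real) \<Rightarrow> real^'n \<Rightarrow> nat \<Rightarrow> real^'n \<Rightarrow> bool" where
  "pdnm_accept \<eta> \<beta> f x k z \<longleftrightarrow>
     f z \<le> f x + gradient f x \<bullet> (z - x) + \<beta> / 2 * (mnorm (pdnm_metric \<eta> f x k) (z - x))\<^sup>2"

text \<open>
  A run of the method without termination consists of the iterates \<open>x t\<close>, the trial points
  \<open>y t k\<close> and the line search indices \<open>K t\<close>.  It is a relation because the prox is a set;
  the values \<open>y t k\<close> with \<open>k > K t\<close> are never computed and hence unconstrained.
\<close>

definition pdnm_run ::
    "real \<Rightarrow> real \<Rightarrow> (real^'n \<Rightarrow> real) \<Rightarrow> (real^'n \<Rightarrow> ereal) \<Rightarrow>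
     (nat \<Rightarrow> real^'n) \<Rightarrow> (nat \<Rightarrow> nat \<Rightarrow> real^'n) \<Rightarrow> (nat \<Rightarrow> nat) \<Rightarrow> bool" where
  "pdnm_run \<eta> \<beta> f g x y K \<longleftrightarrow>
     x 0 \<in> eff_dom g \<and>
     (\<forall>t. (\<forall>k\<le>K t. y t k \<in> pdnm_trial \<eta> f g (x t) k) \<and>
          (\<forall>k<K t. \<not> pdnm_accept \<eta> \<beta> f (x t) k (y t k)) \<and>
          pdnm_accept \<eta> \<beta> f (x t) (K t) (y t (K t)) \<and>
          x (Suc t) = y t (K t))"

end

theory Submission
  imports Defs
begin

text \<open>
  Separability makes the Hessian diagonal, so each trial point is a proximal Newton point with the
  exact Hessian scaled by \<open>\<eta> ^ k\<close>; its optimality condition is a subgradient inequality for \<open>g\<close>.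
  Taking the previous iterate as comparison point there turns acceptance into sufficient decrease
  of \<open>f + g\<close>, hence the steps tend to zero, and strong monotonicity of the gradient then makes
  the iterates a Cauchy sequence. Comparing a full step (\<open>k = 0\<close>) with the limit bounds its error
  by the Taylor remainder of the gradient, which is quadratic in the current error. Full steps are
  therefore eventually short, and since \<open>\<beta> > 1\<close> the second-order Taylor bound accepts them.
\<close>

section \<open>Gradients, Hessians and Taylor estimates\<close>

text \<open>As a definite description, \<open>gradient\<close> yields nothing before existence and
  uniqueness: the adjoint of the derivative at 1 is the Riesz vector, and two such vectors agree
  when tested on their difference.\<close>

lemma has_derivative_gradient:
  fixes f :: "real^'n \<Rightarrow> real"
  assumes "f differentiable (at x)"
  shows "(f has_derivative (\<lambda>h. h \<bullet> gradient f x)) (at x)"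
proof -
  obtain f' where f': "(f has_derivative f') (at x)"
    using assms by (auto simp: differentiable_def)
  have lin: "linear f'"
    using f' by (rule has_derivative_linear)
  define D where "D = adjoint f' 1"
  have "f' h = h \<bullet> D" for h
    using adjoint_works[OF lin, of h 1] by (simp add: D_def)
  then have "f' = (\<lambda>h. h \<bullet> D)"
    by (rule ext)
  then have D: "GDERIV f x :> D"
    using f' by (simp add: gderiv_def)
  have "D' = D" if "GDERIV f x :> D'" for D'
  proof -
    have "(\<lambda>h. h \<bullet> D') = (\<lambda>h. h \<bullet> D)"
      using that D unfolding gderiv_def by (rule has_derivative_unique)
    then have "(D' - D) \<bullet> D' = (D' - D) \<bullet> D"
      by (rule fun_cong)
    then have "(D' - D) \<bullet> (D' - D) = 0"
      by (simp only: inner_diff_right diff_self)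
    then show ?thesis
      by simp
  qed
  then have "GDERIV f x :> gradient f x"
    unfolding gradient_def using D by (rule theI[rotated])
  then show ?thesis
    by (simp add: gderiv_def)
qed

lemma has_real_derivative_along_line:
  fixes f :: "real^'n \<Rightarrow> real"
  assumes "f differentiable (at (x + s *\<^sub>R d))"
  shows "((\<lambda>u. f (x + u *\<^sub>R d)) has_real_derivative d \<bullet> gradient f (x + s *\<^sub>R d)) (at s)"
proof -
  have "((\<lambda>u. x + u *\<^sub>R d) has_derivative (\<lambda>u. u *\<^sub>R d)) (at s)"
    by (auto intro!: derivative_eq_intros)
  from has_derivative_compose[OF this has_derivative_gradient[OF assms]]
  show ?thesis
    by (simp add: has_field_derivative_def mult_commute_abs)
qed

lemma gradient_has_real_derivative_along_line:
  fixes f :: "real^'n \<Rightarrow> real"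
  assumes "gradient f differentiable (at x)"
  shows "((\<lambda>u. e \<bullet> gradient f (x + u *\<^sub>R d)) has_real_derivative e \<bullet> (hessian f x *v d)) (at 0)"
proof -
  have 1: "((\<lambda>u. x + u *\<^sub>R d) has_derivative (\<lambda>u. u *\<^sub>R d)) (at 0)"
    by (auto intro!: derivative_eq_intros)
  have "(gradient f has_derivative (\<lambda>h. hessian f x *v h)) (at (x + 0 *\<^sub>R d))"
    using assms by (simp add: jacobian_works hessian_def)
  from has_derivative_inner_right[OF has_derivative_compose[OF 1 this], of e]
  show ?thesis
    by (simp add: has_field_derivative_def mult_commute_abs matrix_vector_mult_scaleR)
qed

text \<open>Transfers bounds on difference quotients with small positive \<open>u\<close> to the
  derivative.\<close>

lemma has_real_derivative_right_quotient:
  fixes \<phi> :: "real \<Rightarrow> real"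
  assumes "(\<phi> has_real_derivative D) (at 0)"
  shows "((\<lambda>u. (\<phi> u - \<phi> 0) / u) \<longlongrightarrow> D) (at_right 0)"
proof -
  have "(\<phi> has_real_derivative D) (at_right 0)"
    using assms by (rule has_field_derivative_at_within)
  then show ?thesis
    by (simp add: has_field_derivative_iff)
qed

lemma eventually_at_right_unit: "\<forall>\<^sub>F u in at_right (0::real). 0 < u \<and> u < 1"
  by (auto simp: eventually_at_right_field intro: exI[of _ 1])

section \<open>Strong convexity in first- and second-order form\<close>

text \<open>Write strong convexity on the segment from \<open>x\<close> to \<open>z\<close>, divide
  by \<open>u\<close> and let \<open>u\<close> decrease to 0.\<close>

lemma strongly_convex_gradient_le:
  fixes f :: "real^'n \<Rightarrow> real"
  assumes "strongly_convex m f" "f differentiable (at x)"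
  shows "f x + gradient f x \<bullet> (z - x) + m / 2 * (norm (z - x))\<^sup>2 \<le> f z"
proof -
  let ?\<phi> = "\<lambda>u. f (x + u *\<^sub>R (z - x))"
  have "(?\<phi> has_real_derivative (z - x) \<bullet> gradient f x) (at 0)"
    using has_real_derivative_along_line[of f x 0 "z - x"] assms(2) by simp
  note lim = has_real_derivative_right_quotient[OF this]
  have rhs: "((\<lambda>u. f z - f x - m / 2 * (1 - u) * (norm (z - x))\<^sup>2)
      \<longlongrightarrow> f z - f x - m / 2 * (1 - 0) * (norm (z - x))\<^sup>2) (at_right 0)"
    by (intro tendsto_intros)
  have "\<forall>\<^sub>F u in at_right 0.
      (?\<phi> u - ?\<phi> 0) / u \<le> f z - f x - m / 2 * (1 - u) * (norm (z - x))\<^sup>2"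
    using eventually_at_right_unit
  proof eventually_elim
    case (elim u)
    have "f (u *\<^sub>R z + (1 - u) *\<^sub>R x)
        \<le> u * f z + (1 - u) * f x - m / 2 * u * (1 - u) * (norm (z - x))\<^sup>2"
      using assms(1) elim by (auto simp: strongly_convex_def)
    moreover have "u *\<^sub>R z + (1 - u) *\<^sub>R x = x + u *\<^sub>R (z - x)"
      by (simp add: algebra_simps)
    ultimately have "?\<phi> u - ?\<phi> 0 \<le> (f z - f x - m / 2 * (1 - u) * (norm (z - x))\<^sup>2) * u"
      by (simp add: algebra_simps)
    then show ?case
      using elim by (simp only: pos_divide_le_eq)
  qed
  from tendsto_le[OF _ rhs lim this] show ?thesis
    by (simp add: inner_commute)
qed

lemma strongly_convex_gradient_monotone:
  fixes f :: "real^'n \<Rightarrow> real"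
  assumes "strongly_convex m f" "\<And>x. f differentiable (at x)"
  shows "m * (norm (z - x))\<^sup>2 \<le> (gradient f z - gradient f x) \<bullet> (z - x)"
proof -
  have "gradient f z \<bullet> (x - z) = - (gradient f z \<bullet> (z - x))"
    by (simp add: inner_diff_right)
  moreover have "norm (x - z) = norm (z - x)"
    by (rule norm_minus_commute)
  moreover have "m / 2 * (norm (z - x))\<^sup>2 + m / 2 * (norm (z - x))\<^sup>2 = m * (norm (z - x))\<^sup>2"
    by (simp add: field_simps)
  ultimately show ?thesis
    using strongly_convex_gradient_le[OF assms(1) assms(2), of x z]
      strongly_convex_gradient_le[OF assms(1) assms(2), of z x]
    by (simp only: inner_diff_left)
qed

text \<open>Strong monotonicity between \<open>x\<close> and \<open>x + u *\<^sub>R d\<close>,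
  divided by the square of \<open>u\<close>, passes to the limit.\<close>

lemma strongly_convex_hessian_ge:
  fixes f :: "real^'n \<Rightarrow> real"
  assumes "strongly_convex m f" "\<And>x. f differentiable (at x)" "gradient f differentiable (at x)"
  shows "m * (norm d)\<^sup>2 \<le> d \<bullet> (hessian f x *v d)"
proof -
  let ?\<phi> = "\<lambda>u. d \<bullet> gradient f (x + u *\<^sub>R d)"
  note lim = has_real_derivative_right_quotient[OF
      gradient_has_real_derivative_along_line[OF assms(3), of d d]]
  have "\<forall>\<^sub>F u in at_right 0. m * (norm d)\<^sup>2 \<le> (?\<phi> u - ?\<phi> 0) / u"
    using eventually_at_right_unit
  proof eventually_elim
    case (elim u)
    have "u * (m * u * (norm d)\<^sup>2) \<le> u * (?\<phi> u - ?\<phi> 0)"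
      using strongly_convex_gradient_monotone[OF assms(1,2), of "x + u *\<^sub>R d" x]
      by (simp add: inner_diff_left inner_commute power2_eq_square algebra_simps)
    then show ?case
      using elim by (simp add: pos_le_divide_eq mult_ac)
  qed
  then show ?thesis
    by (intro tendsto_lowerbound[OF lim]) auto
qed

section \<open>Lipschitz conditions and Taylor remainders\<close>

lemma lipschitz_hessian_le:
  fixes f :: "real^'n \<Rightarrow> real"
  assumes "L-lipschitz_on UNIV (gradient f)" "gradient f differentiable (at x)"
  shows "norm (hessian f x *v d) \<le> L * norm d"
proof -
  \<comment> \<open>Testing the derivative of the gradient against its own value produces the
    squared norm, from which one factor cancels.\<close>
  let ?e = "hessian f x *v d"
  let ?\<phi> = "\<lambda>u. ?e \<bullet> gradient f (x + u *\<^sub>R d)"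
  note lim = has_real_derivative_right_quotient[OF
      gradient_has_real_derivative_along_line[OF assms(2), of ?e d]]
  have "\<forall>\<^sub>F u in at_right 0. (?\<phi> u - ?\<phi> 0) / u \<le> norm ?e * (L * norm d)"
    using eventually_at_right_unit
  proof eventually_elim
    case (elim u)
    have "?\<phi> u - ?\<phi> 0 \<le> norm ?e * norm (gradient f (x + u *\<^sub>R d) - gradient f x)"
      by (simp add: inner_diff_right[symmetric] norm_cauchy_schwarz)
    also have "\<dots> \<le> norm ?e * (L * norm (u *\<^sub>R d))"
      using lipschitz_onD[OF assms(1), of "x + u *\<^sub>R d" x]
      by (intro mult_left_mono) (auto simp: dist_norm)
    finally show ?case
      using elim by (simp add: pos_divide_le_eq mult_ac)
  qed
  then have "?e \<bullet> ?e \<le> norm ?e * (L * norm d)"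
    by (intro tendsto_upperbound[OF lim]) auto
  moreover have "0 \<le> L * norm d"
    using lipschitz_on_nonneg[OF assms(1)] by simp
  ultimately show ?thesis
    by (cases "?e = 0") (auto simp: dot_square_norm power2_eq_square)
qed

lemma spectral_lipschitz_nonneg:
  fixes M :: "real^'n \<Rightarrow> real^'n^'n"
  assumes "spectral_lipschitz L M"
  shows "0 \<le> L"
proof -
  \<comment> \<open>Here \<open>1\<close> is the all-ones vector; any two distinct points would fix
    the sign of \<open>L\<close>.\<close>
  have "0 \<le> L * norm (1 - 0 :: real^'n)"
    using assms onorm_pos_le[OF matrix_vector_mul_bounded_linear]
    unfolding spectral_lipschitz_def by (meson order_trans)
  then show ?thesis
    by (simp add: zero_le_mult_iff)
qed

text \<open>Mean value inequality on the segment: there the Hessian differs from the one at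
  \<open>x\<close> by at most \<open>L * norm (z - x)\<close> in operator norm. Integration would
  give \<open>L / 2\<close>; the cruder constant suffices.\<close>

lemma spectral_lipschitz_gradient_linearization:
  fixes f :: "real^'n \<Rightarrow> real"
  assumes "spectral_lipschitz L (hessian f)" "\<And>x. gradient f differentiable (at x)"
  shows "norm (gradient f z - gradient f x - hessian f x *v (z - x)) \<le> L * (norm (z - x))\<^sup>2"
proof -
  have L: "0 \<le> L"
    using assms(1) by (rule spectral_lipschitz_nonneg)
  let ?S = "(\<lambda>t. x + t *\<^sub>R (z - x)) ` {0..1}"
  have "norm (gradient f z - gradient f x - hessian f x *v (z - x)) \<le> norm (z - x) * (L * norm (z - x))"
  proof (rule differentiable_bound_linearization[where S = ?S and f' = "\<lambda>w h. hessian f w *v h"])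
    show "(gradient f has_derivative (\<lambda>h. hessian f w *v h)) (at w within ?S)" for w
      using assms(2)[of w] has_derivative_at_withinI by (simp add: jacobian_works hessian_def)
    fix w assume "w \<in> ?S"
    then obtain t where "t \<in> {0..1}" "w = x + t *\<^sub>R (z - x)" by blast
    then have "norm (w - x) \<le> norm (z - x)"
      by (simp add: mult_left_le_one_le)
    then have "L * norm (w - x) \<le> L * norm (z - x)"
      using L by (rule mult_left_mono)
    moreover have "onorm (\<lambda>h. (hessian f w - hessian f x) *v h) \<le> L * norm (w - x)"
      using assms(1) by (simp add: spectral_lipschitz_def)
    ultimately show "onorm ((*v) (hessian f w) - (*v) (hessian f x)) \<le> L * norm (z - x)"
      by (simp add: fun_diff_def matrix_vector_mult_diff_rdistrib)
  qed (auto intro: image_eqI[of _ _ 0])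
  then show ?thesis
    by (simp add: power2_eq_square mult_ac)
qed

lemma taylor_first_order_bound:
  fixes f :: "real^'n \<Rightarrow> real"
  assumes "L-lipschitz_on UNIV (gradient f)" "\<And>x. f differentiable (at x)"
  shows "f z \<le> f x + gradient f x \<bullet> (z - x) + L * (norm (z - x))\<^sup>2"
proof -
  define d where "d = z - x"
  obtain \<xi> where \<xi>: "0 < \<xi>" "\<xi> < 1"
    and eq: "f (x + 1 *\<^sub>R d) - f (x + 0 *\<^sub>R d) = (1 - 0) * (d \<bullet> gradient f (x + \<xi> *\<^sub>R d))"
    using MVT2[of 0 1 "\<lambda>s. f (x + s *\<^sub>R d)" "\<lambda>s. d \<bullet> gradient f (x + s *\<^sub>R d)"]
      has_real_derivative_along_line[OF assms(2)] by auto
  have "d \<bullet> (gradient f (x + \<xi> *\<^sub>R d) - gradient f x) \<le> norm d * (L * norm (\<xi> *\<^sub>R d))"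
    using lipschitz_onD[OF assms(1), of "x + \<xi> *\<^sub>R d" x]
    by (intro order_trans[OF norm_cauchy_schwarz] mult_left_mono) (auto simp: dist_norm)
  also have "\<dots> \<le> norm d * (L * norm d)"
    using \<xi> lipschitz_on_nonneg[OF assms(1)]
    by (intro mult_left_mono) (auto simp: mult_left_le_one_le)
  finally show ?thesis
    using eq by (simp add: d_def inner_diff_right inner_commute power2_eq_square mult_ac)
qed

lemma taylor_second_order_bound:
  fixes f :: "real^'n \<Rightarrow> real"
  assumes "spectral_lipschitz L (hessian f)"
    and "\<And>x. f differentiable (at x)" "\<And>x. gradient f differentiable (at x)"
  shows "f z \<le> f x + gradient f x \<bullet> (z - x) + 1/2 * ((z - x) \<bullet> (hessian f x *v (z - x)))
           + L * (norm (z - x)) ^ 3"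
proof -
  define d where "d = z - x"
  let ?H = "hessian f x *v d"
  \<comment> \<open>The linear and quadratic Taylor terms are subtracted, so that the derivative of
    the rest is \<open>d\<close> paired with the linearization error of the gradient.\<close>
  let ?\<phi> = "\<lambda>s. f (x + s *\<^sub>R d) - s * (d \<bullet> gradient f x) - s\<^sup>2 / 2 * (d \<bullet> ?H)"
  let ?\<phi>' = "\<lambda>s. d \<bullet> gradient f (x + s *\<^sub>R d) - d \<bullet> gradient f x - s * (d \<bullet> ?H)"
  have "(?\<phi> has_real_derivative ?\<phi>' s) (at s)" for s
  proof -
    have "((\<lambda>s. s * (d \<bullet> gradient f x)) has_real_derivative d \<bullet> gradient f x) (at s)"
      "((\<lambda>s. s\<^sup>2 / 2 * (d \<bullet> ?H)) has_real_derivative s * (d \<bullet> ?H)) (at s)"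
      by (auto intro!: derivative_eq_intros)
    with has_real_derivative_along_line[OF assms(2)] show ?thesis
      by (intro DERIV_diff)
  qed
  then obtain \<xi> where \<xi>: "0 < \<xi>" "\<xi> < 1" and eq: "?\<phi> 1 - ?\<phi> 0 = (1 - 0) * ?\<phi>' \<xi>"
    using MVT2[of 0 1 ?\<phi> ?\<phi>'] by auto
  let ?r = "gradient f (x + \<xi> *\<^sub>R d) - gradient f x - hessian f x *v (\<xi> *\<^sub>R d)"
  have "?\<phi>' \<xi> = d \<bullet> ?r"
    by (simp add: inner_diff_right matrix_vector_mult_scaleR)
  also have "\<dots> \<le> norm d * norm ?r"
    by (rule norm_cauchy_schwarz)
  also have "\<dots> \<le> norm d * (L * (norm (\<xi> *\<^sub>R d))\<^sup>2)"
    using spectral_lipschitz_gradient_linearization[OF assms(1,3), of "x + \<xi> *\<^sub>R d" x]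
    by (intro mult_left_mono) auto
  also have "\<dots> \<le> norm d * (L * (norm d)\<^sup>2)"
    using \<xi> spectral_lipschitz_nonneg[OF assms(1)] by (intro mult_left_mono power_mono) (auto simp: mult_left_le_one_le)
  finally have "?\<phi>' \<xi> \<le> L * norm d ^ 3"
    by (simp add: power3_eq_cube power2_eq_square mult_ac)
  then show ?thesis
    using eq by (simp add: d_def inner_commute)
qed

section \<open>Separability and diagonal matrices\<close>

text \<open>The \<open>i\<close>-th partial derivative is the derivative of \<open>fi i\<close>,
  hence depends on coordinate \<open>i\<close> alone and stays constant along axis
  \<open>j\<close>.\<close>

lemma separable_hessian_diagonal:
  fixes f :: "real^'n \<Rightarrow> real"
  assumes sep: "\<And>z. f z = (\<Sum>i\<in>UNIV. fi i (z $ i))"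
    and df: "\<And>x. f differentiable (at x)" and dg: "\<And>x. gradient f differentiable (at x)"
    and "i \<noteq> j"
  shows "hessian f x $ i $ j = 0"
proof -
  have gr: "(fi i has_real_derivative gradient f z $ i) (at (z $ i))" for z
  proof -
    have eq: "f (z + u *\<^sub>R axis i 1) = fi i (z $ i + u) + (\<Sum>k\<in>UNIV - {i}. fi k (z $ k))" for u
      unfolding sep by (subst sum.remove[of _ i]) (auto simp: axis_def intro!: sum.cong)
    have "((\<lambda>u. f (z + u *\<^sub>R axis i 1)) has_real_derivative gradient f z $ i) (at 0)"
      using has_real_derivative_along_line[of f z 0 "axis i 1"] df by (simp add: inner_axis')
    then have "((\<lambda>u. fi i (z $ i + u) + (\<Sum>k\<in>UNIV - {i}. fi k (z $ k)) - (\<Sum>k\<in>UNIV - {i}. fi k (z $ k)))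
        has_real_derivative gradient f z $ i - 0) (at 0)"
      unfolding eq by (intro DERIV_diff DERIV_const)
    then show ?thesis
      using DERIV_shift[of "fi i" "gradient f z $ i" 0 "z $ i"] by (simp add: add.commute)
  qed
  have "gradient f (x + u *\<^sub>R axis j 1) $ i = gradient f x $ i" for u
    using DERIV_unique[OF gr[of "x + u *\<^sub>R axis j 1"]] gr[of x] \<open>i \<noteq> j\<close> by (simp add: axis_def)
  then have "((\<lambda>u. gradient f x $ i) has_real_derivative hessian f x $ i $ j) (at 0)"
    using gradient_has_real_derivative_along_line[OF dg, of "axis i 1" x "axis j 1"]
    by (simp add: inner_axis' matrix_vector_mul_component inner_axis)
  then show ?thesis
    using DERIV_const DERIV_unique by blast
qed

lemma diag_part_eq_self:
  assumes "\<And>i j. i \<noteq> j \<Longrightarrow> A $ i $ j = 0"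
  shows "diag_part A = A"
  using assms by (auto simp: diag_part_def vec_eq_iff)

text \<open>Supplies the symmetry of the metric from its diagonal form, without appeal to equality
  of mixed partial derivatives.\<close>

lemma diag_part_self_adjoint: "u \<bullet> (diag_part A *v v) = (diag_part A *v u) \<bullet> v"
proof -
  have "(diag_part A *v w) $ i = A $ i $ i * w $ i" for w i
    by (simp add: diag_part_def matrix_vector_mult_def if_distrib[where f = "\<lambda>a. a * _"] sum.delta cong: if_cong)
  then show ?thesis
    by (simp add: inner_vec_def mult_ac)
qed

section \<open>Subgradients and proximal points\<close>

text \<open>Finiteness of \<open>g y\<close> is not built in; for proper \<open>g\<close> it follows
  by comparison with a point of the effective domain.\<close>

definition subgradient :: "('a::real_inner \<Rightarrow> ereal) \<Rightarrow> 'a \<Rightarrow> 'a \<Rightarrow> bool" where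
  "subgradient g y v \<longleftrightarrow> (\<forall>w. g y + ereal (v \<bullet> (w - y)) \<le> g w)"

lemma subgradient_finite:
  assumes "proper_fun g" "subgradient g y v"
  obtains r where "g y = ereal r"
proof -
  obtain w where "g w < \<infinity>"
    using assms(1) by (auto simp: proper_fun_def eff_dom_def)
  moreover have "g y + ereal (v \<bullet> (w - y)) \<le> g w"
    using assms(2) by (simp add: subgradient_def)
  ultimately have "g y \<noteq> \<infinity>"
    by auto
  moreover have "g y \<noteq> -\<infinity>"
    using assms(1) by (simp add: proper_fun_def)
  ultimately show thesis
    using that by (cases "g y") auto
qed

lemma subgradient_monotone:
  assumes "proper_fun g" "subgradient g y v" "subgradient g y' v'"
  shows "0 \<le> (v - v') \<bullet> (y - y')"
proof -
  obtain r r' where "g y = ereal r" "g y' = ereal r'"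
    using subgradient_finite assms by metis
  moreover have "g y + ereal (v \<bullet> (y' - y)) \<le> g y'" "g y' + ereal (v' \<bullet> (y - y')) \<le> g y"
    using assms by (auto simp: subgradient_def)
  ultimately show ?thesis
    by (simp add: inner_diff_left inner_diff_right)
qed

text \<open>For finite \<open>g w\<close>, the subgradient inequality says that a point built
  continuously from \<open>y t\<close> and \<open>v t\<close> lies in the epigraph, which is
  closed.\<close>

lemma subgradient_closed:
  assumes "proper_fun g" "closed_fun g" and "\<And>t::nat. subgradient g (y t) (v t)"
    and y: "y \<longlonglongrightarrow> y'" and v: "v \<longlonglongrightarrow> v'"
  shows "subgradient g y' v'"
  unfolding subgradient_def
proof
  fix w
  show "g y' + ereal (v' \<bullet> (w - y')) \<le> g w"
  proof (cases "g w")
    case (real b)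
    have "(y t, b - v t \<bullet> (w - y t)) \<in> epi g" for t
    proof -
      have "g (y t) + ereal (v t \<bullet> (w - y t)) \<le> ereal b"
        using assms(3)[of t] real by (metis subgradient_def)
      then show ?thesis
        by (cases "g (y t)") (auto simp: epi_def)
    qed
    moreover have "(\<lambda>t. (y t, b - v t \<bullet> (w - y t))) \<longlonglongrightarrow> (y', b - v' \<bullet> (w - y'))"
      by (intro tendsto_intros y v)
    ultimately have "(y', b - v' \<bullet> (w - y')) \<in> epi g"
      using assms(2) unfolding closed_fun_def by (rule_tac closed_sequentially)
    then show ?thesis
      using real by (cases "g y'") (auto simp: epi_def)
  qed (use assms(1) in \<open>auto simp: proper_fun_def\<close>)
qed

text \<open>Fermat's rule: move from the minimizer \<open>y\<close> a fraction \<open>u\<close>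
  towards \<open>w\<close>, bound \<open>g\<close> by its chord, divide by \<open>u\<close> and let
  \<open>u\<close> tend to 0. The quadratic term has gradient \<open>A *v (y - c)\<close> at
  \<open>y\<close>.\<close>

lemma subgradient_prox:
  fixes g :: "real^'n \<Rightarrow> ereal"
  assumes g: "proper_fun g" "convex_fun g"
    and sym: "\<And>u v. u \<bullet> (A *v v) = (A *v u) \<bullet> v"
    and pos: "\<And>u. u \<noteq> 0 \<Longrightarrow> 0 < u \<bullet> (A *v u)"
    and y: "y \<in> prox g A (x - matrix_inv A *v p)"
  shows "subgradient g y (- (p + A *v (y - x)))"
  unfolding subgradient_def
proof
  fix w
  define c where "c = x - matrix_inv A *v p"
  define q where "q z = 1/2 * ((z - c) \<bullet> (A *v (z - c)))" for z
  \<comment> \<open>Positive definiteness gives a trivial kernel, so \<open>matrix_inv A\<close> is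
    a genuine inverse.\<close>
  have "z = 0" if "A *v z = 0" for z
    using pos[of z] that by auto
  then have "invertible A"
    by (simp add: invertible_left_inverse matrix_left_invertible_ker)
  then have "A ** matrix_inv A = mat 1"
    unfolding invertible_def matrix_inv_def by (rule someI2_ex) simp
  then have "A *v (matrix_inv A *v p) = p"
    by (simp add: matrix_vector_mul_assoc)
  then have Ac: "A *v (y - c) = p + A *v (y - x)"
    by (simp add: c_def algebra_simps matrix_vector_mult_diff_distrib)
  have pos': "0 \<le> u \<bullet> (A *v u)" for u
    using pos[of u] by (cases "u = 0") auto
  have min: "g y + ereal (q y) \<le> g z + ereal (q z)" for z
  proof -
    have q: "q z = 1/2 * (mnorm A (z - c))\<^sup>2" for z
      using pos' by (simp add: q_def mnorm_def)
    show ?thesis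
      using y unfolding q by (simp add: prox_def is_arg_min_def not_less flip: c_def)
  qed
  show "g y + ereal (- (p + A *v (y - x)) \<bullet> (w - y)) \<le> g w"
  proof (cases "g w")
    case (real b)
    have "g y \<noteq> \<infinity>"
      using min[of w] real by auto
    then obtain a where a: "g y = ereal a"
      using g(1) by (cases "g y") (auto simp: proper_fun_def)
    define d where "d = w - y"
    have ev: "\<forall>\<^sub>F u in at_right 0. 0 \<le> b - a + (A *v (y - c)) \<bullet> d + u * (1/2 * (d \<bullet> (A *v d)))"
      using eventually_at_right_unit
    proof eventually_elim
      case (elim u)
      have "(y, a) \<in> epi g" "(w, b) \<in> epi g"
        using a real by (auto simp: epi_def)
      then have "(1 - u) *\<^sub>R (y, a) + u *\<^sub>R (w, b) \<in> epi g"
        using g(2) elim by (intro convexD) (auto simp: convex_fun_def)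
      moreover have "(1 - u) *\<^sub>R y + u *\<^sub>R w = y + u *\<^sub>R d"
        by (simp add: d_def algebra_simps)
      ultimately have "g (y + u *\<^sub>R d) \<le> ereal ((1 - u) * a + u * b)"
        by (simp add: epi_def)
      with min[of "y + u *\<^sub>R d"] a have "a + q y \<le> (1 - u) * a + u * b + q (y + u *\<^sub>R d)"
        by (cases "g (y + u *\<^sub>R d)") auto
      \<comment> \<open>Symmetry of \<open>A\<close> merges the two cross terms of the
        expansion.\<close>
      moreover have "q (y + u *\<^sub>R d) = q y + u * ((A *v (y - c)) \<bullet> d) + u * u * (1/2 * (d \<bullet> (A *v d)))"
      proof -
        have "y + u *\<^sub>R d - c = (y - c) + u *\<^sub>R d"
          by simp
        then have "q (y + u *\<^sub>R d) = 1/2 * (((y - c) + u *\<^sub>R d) \<bullet> (A *v ((y - c) + u *\<^sub>R d)))"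
          by (simp only: q_def)
        also have "\<dots> = q y + u * ((A *v (y - c)) \<bullet> d) + u * u * (1/2 * (d \<bullet> (A *v d)))"
          unfolding matrix_vector_right_distrib matrix_vector_mult_scaleR inner_add_left inner_add_right
            q_def inner_scaleR_left inner_scaleR_right sym[of "y - c" d] inner_commute[of d "A *v (y - c)"]
          by (simp add: algebra_simps)
        finally show ?thesis .
      qed
      ultimately have "0 \<le> u * (b - a + (A *v (y - c)) \<bullet> d + u * (1/2 * (d \<bullet> (A *v d))))"
        by (simp add: algebra_simps)
      then show ?case
        using elim by (simp add: zero_le_mult_iff)
    qed
    have "((\<lambda>u. b - a + (A *v (y - c)) \<bullet> d + u * (1/2 * (d \<bullet> (A *v d))))
        \<longlongrightarrow> b - a + (A *v (y - c)) \<bullet> d + 0 * (1/2 * (d \<bullet> (A *v d)))) (at_right 0)"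
      by (intro tendsto_intros)
    from tendsto_lowerbound[OF this ev] have "0 \<le> b - a + (A *v (y - c)) \<bullet> d"
      by simp
    then show ?thesis
      using real a by (simp add: Ac d_def inner_add_left inner_diff_left)
  qed (use g(1) in \<open>auto simp: proper_fun_def\<close>)
qed

section \<open>Convergence of the proximal diagonal Newton method\<close>

text \<open>The run and the lower bound of \<open>f + g\<close> stay outside, so that the one-step
  estimates hold at an arbitrary base point.\<close>

locale pdnm_problem =
  fixes f :: "real^'n \<Rightarrow> real"
    and fi :: "'n \<Rightarrow> real \<Rightarrow> real"
    and g :: "real^'n \<Rightarrow> ereal"
    and \<eta> \<beta> m L1 L2 :: real
  assumes smooth: "twice_continuously_differentiable f"
    and proper: "proper_fun g" and closed: "closed_fun g" and convex: "convex_fun g"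
    and eta: "\<eta> > 1" and beta: "1 < \<beta>" "\<beta> < 2"
    and separable: "\<And>z. f z = (\<Sum>i\<in>UNIV. fi i (z $ i))"
    and m: "m > 0" and strong: "strongly_convex m f"
    and lipschitz: "L1-lipschitz_on UNIV (gradient f)"
    and hessian_lipschitz: "spectral_lipschitz L2 (hessian f)"
begin

lemma f_differentiable: "f differentiable (at x)"
  and gradient_differentiable: "gradient f differentiable (at x)"
  using smooth by (auto simp: twice_continuously_differentiable_def)

lemma L2_nonneg: "0 \<le> L2"
  using hessian_lipschitz by (rule spectral_lipschitz_nonneg)

lemma hessian_ge: "m * (norm d)\<^sup>2 \<le> d \<bullet> (hessian f x *v d)"
  using strong f_differentiable gradient_differentiable by (rule strongly_convex_hessian_ge)

lemma gradient_monotone: "m * (norm (z - x))\<^sup>2 \<le> (gradient f z - gradient f x) \<bullet> (z - x)"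
  using strong f_differentiable by (rule strongly_convex_gradient_monotone)

text \<open>This is where separability enters: the diagonal metric is the exact Hessian up to the
  factor \<open>\<eta> ^ k\<close>.\<close>

lemma diag_hessian: "diag_part (hessian f x) = hessian f x"
  using separable_hessian_diagonal[OF separable f_differentiable gradient_differentiable]
  by (rule diag_part_eq_self)

lemma pdnm_metric_mult: "pdnm_metric \<eta> f x k *v d = \<eta> ^ k *\<^sub>R (hessian f x *v d)"
  by (simp add: pdnm_metric_def diag_hessian scaleR_matrix_vector_assoc)

lemma hessian_nonneg: "0 \<le> d \<bullet> (hessian f x *v d)"
  using hessian_ge[of d x] m by (meson order_trans mult_nonneg_nonneg less_imp_le zero_le_power2)

lemma mnorm_pdnm_metric:
  "(mnorm (pdnm_metric \<eta> f x k) d)\<^sup>2 = \<eta> ^ k * (d \<bullet> (hessian f x *v d))"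
  using hessian_nonneg[of d x] eta by (simp add: mnorm_def pdnm_metric_mult)

lemma mnorm_pdnm_metric_ge: "m * \<eta> ^ k * (norm d)\<^sup>2 \<le> (mnorm (pdnm_metric \<eta> f x k) d)\<^sup>2"
proof -
  have "\<eta> ^ k * (m * (norm d)\<^sup>2) \<le> \<eta> ^ k * (d \<bullet> (hessian f x *v d))"
    using hessian_ge eta by (intro mult_left_mono) auto
  then show ?thesis
    by (simp add: mnorm_pdnm_metric mult_ac)
qed

lemma pdnm_trial_subgradient:
  assumes "z \<in> pdnm_trial \<eta> f g x k"
  shows "subgradient g z (- (gradient f x + \<eta> ^ k *\<^sub>R (hessian f x *v (z - x))))"
  unfolding pdnm_metric_mult[symmetric]
proof (rule subgradient_prox[OF proper convex])
  show "z \<in> prox g (pdnm_metric \<eta> f x k) (x - matrix_inv (pdnm_metric \<eta> f x k) *v gradient f x)"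
    using assms by (simp add: pdnm_trial_def)
  show "u \<bullet> (pdnm_metric \<eta> f x k *v v) = (pdnm_metric \<eta> f x k *v u) \<bullet> v" for u v
    using diag_part_self_adjoint[of u "hessian f x" v] by (simp add: pdnm_metric_mult diag_hessian)
  show "0 < u \<bullet> (pdnm_metric \<eta> f x k *v u)" if "u \<noteq> 0" for u
  proof -
    have "0 < m * (norm u)\<^sup>2"
      using m that by simp
    then have "0 < u \<bullet> (hessian f x *v u)"
      using hessian_ge less_le_trans by blast
    then show ?thesis
      using eta by (simp add: pdnm_metric_mult)
  qed
qed

section \<open>Acceptance tests and sufficient decrease\<close>

text \<open>Bounds the backtracking uniformly: beyond this threshold the metric term dominates the
  first-order Taylor remainder for every \<open>z\<close>.\<close>

lemma pdnm_accept_large: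
  assumes "2 * L1 \<le> \<beta> * m * \<eta> ^ k"
  shows "pdnm_accept \<eta> \<beta> f x k z"
proof -
  have "2 * L1 * (norm (z - x))\<^sup>2 \<le> \<beta> * m * \<eta> ^ k * (norm (z - x))\<^sup>2"
    using assms by (rule mult_right_mono) simp
  also have "\<dots> \<le> \<beta> * (mnorm (pdnm_metric \<eta> f x k) (z - x))\<^sup>2"
    using mult_left_mono[OF mnorm_pdnm_metric_ge[of k "z - x" x], of \<beta>] beta by (simp add: mult_ac)
  finally show ?thesis
    using taylor_first_order_bound[OF lipschitz f_differentiable, of z x]
    by (simp add: pdnm_accept_def)
qed

text \<open>The metric term exceeds the second-order Taylor term by
  \<open>(\<beta> - 1) / 2 * ?q\<close>; for a short step this slack absorbs the cubic remainder
  because \<open>?q\<close> is at least \<open>m\<close> times the squared step length.\<close>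

lemma pdnm_accept_near:
  assumes "L2 * norm (z - x) \<le> (\<beta> - 1) / 2 * m"
  shows "pdnm_accept \<eta> \<beta> f x 0 z"
proof -
  let ?q = "(z - x) \<bullet> (hessian f x *v (z - x))"
  have "L2 * norm (z - x) ^ 3 = L2 * norm (z - x) * (norm (z - x))\<^sup>2"
    by (simp add: power3_eq_cube power2_eq_square)
  also have "\<dots> \<le> (\<beta> - 1) / 2 * m * (norm (z - x))\<^sup>2"
    using assms by (rule mult_right_mono) simp
  also have "\<dots> \<le> (\<beta> - 1) / 2 * ?q"
    using mult_left_mono[OF hessian_ge[of "z - x" x], of "(\<beta> - 1) / 2"] beta by (simp add: mult_ac)
  finally have "1/2 * ?q + L2 * norm (z - x) ^ 3 \<le> \<beta> / 2 * ?q"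
    by (simp add: field_simps)
  then show ?thesis
    using taylor_second_order_bound[OF hessian_lipschitz f_differentiable gradient_differentiable, of z x]
    by (simp add: pdnm_accept_def mnorm_pdnm_metric)
qed

text \<open>Adding the acceptance test to the subgradient inequality at \<open>z\<close> tested in
  \<open>x\<close> cancels the gradient terms and leaves \<open>(1 - \<beta> / 2) * ?n\<close>, with
  a positive factor since \<beta> < 2.\<close>

lemma pdnm_descent:
  assumes "z \<in> pdnm_trial \<eta> f g x k" "pdnm_accept \<eta> \<beta> f x k z"
    and gx: "g x = ereal a" and gz: "g z = ereal b"
  shows "f z + b + (1 - \<beta> / 2) * m * (norm (z - x))\<^sup>2 \<le> f x + a"
proof -
  let ?n = "(mnorm (pdnm_metric \<eta> f x k) (z - x))\<^sup>2"
  have "- (gradient f x + \<eta> ^ k *\<^sub>R (hessian f x *v (z - x))) \<bullet> (x - z)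
      = gradient f x \<bullet> (z - x) + ?n"
    by (simp add: mnorm_pdnm_metric inner_commute algebra_simps)
  then have sub: "b + gradient f x \<bullet> (z - x) + ?n \<le> a"
    using pdnm_trial_subgradient[OF assms(1), unfolded subgradient_def, rule_format, of x] gx gz
    by simp
  have "m * 1 * (norm (z - x))\<^sup>2 \<le> m * \<eta> ^ k * (norm (z - x))\<^sup>2"
    using m eta by (intro mult_right_mono mult_left_mono) auto
  then have "m * (norm (z - x))\<^sup>2 \<le> ?n"
    using mnorm_pdnm_metric_ge[of k "z - x" x] by linarith
  then have "(1 - \<beta> / 2) * (m * (norm (z - x))\<^sup>2) \<le> (1 - \<beta> / 2) * ?n"
    using beta by (intro mult_left_mono) auto
  then have "(1 - \<beta> / 2) * m * (norm (z - x))\<^sup>2 \<le> ?n - \<beta> / 2 * ?n"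
    by (simp add: algebra_simps)
  then show ?thesis
    using sub assms(2) unfolding pdnm_accept_def by linarith
qed

section \<open>Newton error estimate and the unique minimizer\<close>

text \<open>The optimality conditions at \<open>z\<close> and \<open>xs\<close> are compared by
  monotonicity of subgradients; the Hessian bounds the result from below, the linearization error
  \<open>?r\<close> from above.\<close>

lemma full_step_error:
  assumes z: "z \<in> pdnm_trial \<eta> f g x 0" and xs: "subgradient g xs (- gradient f xs)"
  shows "norm (z - xs) \<le> L2 / m * (norm (x - xs))\<^sup>2"
proof -
  let ?H = "hessian f x" and ?d = "z - xs"
  let ?r = "gradient f xs - gradient f x - ?H *v (xs - x)"
  have "0 \<le> (- (gradient f x + ?H *v (z - x)) - - gradient f xs) \<bullet> ?d"
    using subgradient_monotone[OF proper pdnm_trial_subgradient[OF z] xs] by simp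
  \<comment> \<open>Splitting \<open>z - x\<close> at \<open>xs\<close> separates the known error of
    \<open>x\<close> from the unknown \<open>?d\<close>.\<close>
  moreover have "- (gradient f x + ?H *v (z - x)) - - gradient f xs = ?r - ?H *v ?d"
    by (simp add: algebra_simps)
  ultimately have "0 \<le> (?r - ?H *v ?d) \<bullet> ?d"
    by (simp only:)
  then have "?d \<bullet> (?H *v ?d) \<le> ?r \<bullet> ?d"
    by (simp only: inner_diff_left[of ?r] inner_commute[of ?d "?H *v ?d"] diff_ge_0_iff_ge)
  also have "\<dots> \<le> norm ?r * norm ?d"
    by (rule norm_cauchy_schwarz)
  also have "\<dots> \<le> L2 * (norm (x - xs))\<^sup>2 * norm ?d"
    using spectral_lipschitz_gradient_linearization[OF hessian_lipschitz gradient_differentiable, of xs x]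
    by (intro mult_right_mono) (simp_all add: norm_minus_commute)
  finally have "m * (norm ?d)\<^sup>2 \<le> L2 * (norm (x - xs))\<^sup>2 * norm ?d"
    using hessian_ge order_trans by blast
  then have "norm ?d * (m * norm ?d) \<le> norm ?d * (L2 * (norm (x - xs))\<^sup>2)"
    by (simp add: power2_eq_square mult_ac)
  then have "m * norm ?d \<le> L2 * (norm (x - xs))\<^sup>2"
    using L2_nonneg by (cases "?d = 0") (auto simp: mult_le_cancel_left)
  then show ?thesis
    using m by (simp add: field_simps)
qed

text \<open>The subgradient inequality and strong convexity of \<open>f\<close>, both based at
  \<open>xs\<close>, add up to quadratic growth of \<open>f + g\<close>: their linear terms
  cancel.\<close>

lemma is_arg_min_iff:
  assumes xs: "subgradient g xs (- gradient f xs)"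
  shows "is_arg_min (\<lambda>z. ereal (f z) + g z) (\<lambda>_. True) z \<longleftrightarrow> z = xs"
proof -
  obtain a where a: "g xs = ereal a"
    using subgradient_finite[OF proper xs] .
  have growth: "ereal (f xs + a + m / 2 * (norm (w - xs))\<^sup>2) \<le> ereal (f w) + g w" for w
  proof -
    have "g xs + ereal (- gradient f xs \<bullet> (w - xs)) \<le> g w"
      using xs by (simp add: subgradient_def)
    then show ?thesis
      using a strongly_convex_gradient_le[OF strong f_differentiable, of xs w]
      by (cases "g w") auto
  qed
  have min: "ereal (f xs) + g xs \<le> ereal (f w) + g w" for w
  proof -
    have "0 \<le> m / 2 * (norm (w - xs))\<^sup>2"
      using m by simp
    then have "ereal (f xs + a) \<le> ereal (f xs + a + m / 2 * (norm (w - xs))\<^sup>2)"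
      by simp
    also note growth
    finally show ?thesis
      using a by simp
  qed
  moreover have "ereal (f xs) + g xs < ereal (f w) + g w" if "w \<noteq> xs" for w
  proof -
    have "0 < m / 2 * (norm (w - xs))\<^sup>2"
      using m that by simp
    then have "ereal (f xs + a) < ereal (f xs + a + m / 2 * (norm (w - xs))\<^sup>2)"
      by simp
    also note growth
    finally show ?thesis
      using a by simp
  qed
  ultimately show ?thesis
    unfolding is_arg_min_def by (metis not_less)
qed

text \<open>
  The limit of the iterates is shown to satisfy the optimality condition, so the existence of a
  minimizer is a by-product and needs no coercivity argument.
\<close>

lemma pdnm_convergence:
  assumes run: "pdnm_run \<eta> \<beta> f g x y K"
    and bounded: "\<And>z. ereal b \<le> ereal (f z) + g z"
  obtains xs where "subgradient g xs (- gradient f xs)" "x \<longlonglongrightarrow> xs"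
proof -
  have trial: "x (Suc t) \<in> pdnm_trial \<eta> f g (x t) (K t)"
    and accept: "pdnm_accept \<eta> \<beta> f (x t) (K t) (x (Suc t))"
    and reject: "k < K t \<Longrightarrow> \<not> pdnm_accept \<eta> \<beta> f (x t) k (y t k)" for t k
    using run by (auto simp: pdnm_run_def)
  define v where "v t = - (gradient f (x t) + \<eta> ^ K t *\<^sub>R (hessian f (x t) *v (x (Suc t) - x t)))" for t
  have sub: "subgradient g (x (Suc t)) (v t)" for t
    unfolding v_def by (rule pdnm_trial_subgradient[OF trial])

  \<comment> \<open>The starting point lies in the effective domain by assumption, every later
    iterate because it carries a subgradient.\<close>
  have "g (x t) \<noteq> \<infinity>" for t
  proof (cases t)
    case 0
    then show ?thesis
      using run by (auto simp: pdnm_run_def eff_dom_def)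
  next
    case (Suc s)
    obtain r where "g (x (Suc s)) = ereal r"
      by (rule subgradient_finite[OF proper sub])
    then show ?thesis
      by (simp add: Suc)
  qed
  moreover have "g (x t) \<noteq> -\<infinity>" for t
    using proper by (simp add: proper_fun_def)
  ultimately have "g (x t) = ereal (real_of_ereal (g (x t)))" for t
    by (cases "g (x t)") auto
  then obtain a where a: "\<And>t. g (x t) = ereal (a t)"
    by (rule that)
  define \<Phi> where "\<Phi> t = f (x t) + a t" for t
  define c where "c = (1 - \<beta> / 2) * m"
  have c: "0 < c"
    using beta m by (simp add: c_def)
  have descent: "c * (norm (x (Suc t) - x t))\<^sup>2 \<le> \<Phi> t - \<Phi> (Suc t)" for t
    using pdnm_descent[OF trial[of t] accept[of t] a a] by (simp add: c_def \<Phi>_def)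
  have "\<Phi> (Suc t) \<le> \<Phi> t" for t
  proof -
    have "0 \<le> c * (norm (x (Suc t) - x t))\<^sup>2"
      using c by simp
    then show ?thesis
      using descent[of t] by linarith
  qed
  then have "decseq \<Phi>"
    by (rule decseq_SucI)
  moreover have "\<forall>t. b \<le> \<Phi> t"
  proof
    show "b \<le> \<Phi> t" for t
      using bounded[of "x t"] by (simp add: a \<Phi>_def)
  qed
  ultimately obtain l where l: "\<Phi> \<longlonglongrightarrow> l" and "\<forall>t. l \<le> \<Phi> t"
    by (rule decseq_convergent)
  \<comment> \<open>The decreases of a convergent sequence vanish, and they bound the squared step
    lengths.\<close>
  have "(\<lambda>t. (\<Phi> t - \<Phi> (Suc t)) / c) \<longlonglongrightarrow> (l - l) / c"
    by (rule tendsto_divide[OF tendsto_diff[OF l LIMSEQ_Suc[OF l]] tendsto_const]) (use c in simp)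
  then have lim: "(\<lambda>t. (\<Phi> t - \<Phi> (Suc t)) / c) \<longlonglongrightarrow> 0"
    by simp
  have "(norm (x (Suc t) - x t))\<^sup>2 \<le> (\<Phi> t - \<Phi> (Suc t)) / c" for t
    using descent[of t] c by (simp add: pos_le_divide_eq mult.commute)
  then have "\<forall>\<^sub>F t in sequentially. norm ((norm (x (Suc t) - x t))\<^sup>2) \<le> (\<Phi> t - \<Phi> (Suc t)) / c"
    by simp
  then have "(\<lambda>t. (norm (x (Suc t) - x t))\<^sup>2) \<longlonglongrightarrow> 0"
    using lim by (rule Lim_null_comparison)
  from tendsto_real_sqrt[OF this] have steps: "(\<lambda>t. norm (x (Suc t) - x t)) \<longlonglongrightarrow> 0"
    by simp

  \<comment> \<open>Index \<open>N\<close> always passes the test, so no search goes beyond it; this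
    keeps the factors \<open>\<eta> ^ K t\<close> bounded in the estimate of
    \<open>e\<close>.\<close>
  obtain N where N: "2 * L1 / (\<beta> * m) < \<eta> ^ N"
    using real_arch_pow[OF eta] by blast
  have "2 * L1 \<le> \<beta> * m * \<eta> ^ N"
    using N beta m by (simp add: pos_divide_less_eq mult_ac less_imp_le)
  then have "K t \<le> N" for t
    using reject[of N t] pdnm_accept_large[of N] by (meson not_less)
  then have pow: "\<eta> ^ K t \<le> \<eta> ^ N" for t
    using eta by (intro power_increasing) auto

  \<comment> \<open>The optimality residual: a subgradient of \<open>f + g\<close> at the new
    iterate, controlled by the step length.\<close>
  define e where "e t = gradient f (x (Suc t)) + v t" for t
  have e_le: "norm (e t) \<le> (L1 + \<eta> ^ N * L1) * norm (x (Suc t) - x t)" for t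
  proof -
    let ?h = "hessian f (x t) *v (x (Suc t) - x t)"
    have "e t = (gradient f (x (Suc t)) - gradient f (x t)) - \<eta> ^ K t *\<^sub>R ?h"
      by (simp add: e_def v_def)
    then have "norm (e t) \<le> norm (gradient f (x (Suc t)) - gradient f (x t)) + norm (\<eta> ^ K t *\<^sub>R ?h)"
      by (simp only: norm_triangle_ineq4)
    moreover have "norm (gradient f (x (Suc t)) - gradient f (x t)) \<le> L1 * norm (x (Suc t) - x t)"
      using lipschitz_onD[OF lipschitz] by (simp add: dist_norm)
    moreover have "norm (\<eta> ^ K t *\<^sub>R ?h) \<le> \<eta> ^ N * (L1 * norm (x (Suc t) - x t))"
      using lipschitz_hessian_le[OF lipschitz gradient_differentiable] pow[of t] eta
      by (simp add: mult_mono)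
    ultimately show ?thesis
      by (simp add: algebra_simps)
  qed
  have e: "e \<longlonglongrightarrow> 0"
    by (rule Lim_null_comparison[OF always_eventually tendsto_mult_right_zero[OF steps]]) (use e_le in auto)

  \<comment> \<open>Strong monotonicity of the gradient plus monotonicity of subgradients: iterates
    are as close as their residuals, up to \<open>m\<close>, so vanishing residuals force a Cauchy
    sequence.\<close>
  have close: "m * norm (x (Suc t) - x (Suc s)) \<le> norm (e t - e s)" for t s
  proof -
    let ?d = "x (Suc t) - x (Suc s)"
    have "0 \<le> (v t - v s) \<bullet> ?d"
      using subgradient_monotone[OF proper sub sub] .
    then have "(gradient f (x (Suc t)) - gradient f (x (Suc s))) \<bullet> ?d \<le> (e t - e s) \<bullet> ?d"
      by (simp add: e_def inner_diff_left inner_add_left)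
    then have "m * (norm ?d)\<^sup>2 \<le> norm (e t - e s) * norm ?d"
      using gradient_monotone[of "x (Suc t)" "x (Suc s)"] norm_cauchy_schwarz[of "e t - e s" ?d]
      by linarith
    then have "norm ?d * (m * norm ?d) \<le> norm ?d * norm (e t - e s)"
      by (simp add: power2_eq_square mult_ac)
    then show ?thesis
      by (cases "?d = 0") (auto simp: mult_le_cancel_left)
  qed
  have "Cauchy (\<lambda>t. x (Suc t))"
  proof (rule CauchyI)
    fix \<epsilon> :: real assume "0 < \<epsilon>"
    then have "0 < m * \<epsilon>"
      using m by simp
    then obtain M where "\<forall>t\<ge>M. \<forall>s\<ge>M. norm (e t - e s) < m * \<epsilon>"
      using CauchyD[OF LIMSEQ_imp_Cauchy[OF e]] by blast
    then have "\<forall>t\<ge>M. \<forall>s\<ge>M. m * norm (x (Suc t) - x (Suc s)) < m * \<epsilon>"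
      using le_less_trans[OF close] by simp
    then show "\<exists>M. \<forall>t\<ge>M. \<forall>s\<ge>M. norm (x (Suc t) - x (Suc s)) < \<epsilon>"
      using m by (auto simp: mult_less_cancel_left_pos)
  qed
  then obtain xs where xs: "(\<lambda>t. x (Suc t)) \<longlonglongrightarrow> xs"
    using Cauchy_convergent convergent_def by blast
  have "isCont (gradient f) xs"
    using gradient_differentiable by (rule differentiable_imp_continuous_within)
  then have "(\<lambda>t. gradient f (x (Suc t))) \<longlonglongrightarrow> gradient f xs"
    using xs by (rule isCont_tendsto_compose)
  with e have "(\<lambda>t. e t - gradient f (x (Suc t))) \<longlonglongrightarrow> 0 - gradient f xs"
    by (rule tendsto_diff)
  then have "v \<longlonglongrightarrow> - gradient f xs"
    by (simp add: e_def)
  with proper closed sub xs have "subgradient g xs (- gradient f xs)"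
    by (rule subgradient_closed)
  moreover have "x \<longlonglongrightarrow> xs"
    using xs by (rule LIMSEQ_imp_Suc)
  ultimately show thesis
    by (rule that)
qed

text \<open>The trial point with \<open>k = 0\<close> is computed at every iteration, so
  \<open>full_step_error\<close> applies to it before acceptance is known.\<close>

lemma pdnm_eventually_full_step:
  assumes run: "pdnm_run \<eta> \<beta> f g x y K"
    and xs: "subgradient g xs (- gradient f xs)" and lim: "x \<longlonglongrightarrow> xs"
  shows "\<forall>\<^sub>F t in sequentially. K t = 0"
proof -
  have trial: "y t 0 \<in> pdnm_trial \<eta> f g (x t) 0" for t
    using run by (auto simp: pdnm_run_def)
  have "(\<lambda>t. L2 / m * (norm (x t - xs))\<^sup>2) \<longlonglongrightarrow> L2 / m * (norm (xs - xs))\<^sup>2"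
    by (intro tendsto_intros lim)
  then have "(\<lambda>t. L2 / m * (norm (x t - xs))\<^sup>2) \<longlonglongrightarrow> 0"
    by simp
  then have "(\<lambda>t. y t 0 - xs) \<longlonglongrightarrow> 0"
    by (rule Lim_null_comparison[OF always_eventually[rule_format, OF full_step_error[OF trial xs]]])
  \<comment> \<open>The full step is the difference of two vanishing errors, hence eventually short
    enough for \<open>pdnm_accept_near\<close>.\<close>
  then have "(\<lambda>t. L2 * norm ((y t 0 - xs) - (x t - xs))) \<longlonglongrightarrow> L2 * norm (0 - (xs - xs))"
    by (intro tendsto_intros lim)
  moreover have "L2 * norm (0 - (xs - xs)) < (\<beta> - 1) / 2 * m"
    using beta m by simp
  ultimately have "\<forall>\<^sub>F t in sequentially. L2 * norm ((y t 0 - xs) - (x t - xs)) < (\<beta> - 1) / 2 * m"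
    by (rule order_tendstoD(2))
  then show ?thesis
  proof eventually_elim
    case (elim t)
    then have "pdnm_accept \<eta> \<beta> f (x t) 0 (y t 0)"
      by (intro pdnm_accept_near) simp
    then show ?case
      using run by (auto simp: pdnm_run_def)
  qed
qed

end

theorem theorem2p3:
  fixes f :: "real^'n \<Rightarrow> real"
    and fi :: "'n \<Rightarrow> real \<Rightarrow> real"
    and g F :: "real^'n \<Rightarrow> ereal"
    and \<eta> \<beta> m L1 L2 :: real
    and x :: "nat \<Rightarrow> real^'n"
    and y :: "nat \<Rightarrow> nat \<Rightarrow> real^'n"
    and K :: "nat \<Rightarrow> nat"
  defines "F \<equiv> (\<lambda>z. ereal (f z) + g z)"
  assumes "twice_continuously_differentiable f"
    and "proper_fun g" and "closed_fun g" and "directionally_differentiable g"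
    and "\<exists>b::real. \<forall>z. ereal b \<le> F z"
    and "\<eta> > 1" and "1 < \<beta>" and "\<beta> < 2"
    and "\<And>z. f z = (\<Sum>i\<in>UNIV. fi i (z $ i))"
    and "pdnm_run \<eta> \<beta> f g x y K"
    and "m > 0" and "strongly_convex m f"
    and "L1-lipschitz_on UNIV (gradient f)"
    and "spectral_lipschitz L2 (hessian f)"
    and "convex_fun g"
  shows "\<exists>xs. (\<forall>z. is_arg_min F (\<lambda>_. True) z \<longleftrightarrow> z = xs) \<and>
              x \<longlonglongrightarrow> xs \<and>
              (\<forall>\<^sub>F t in sequentially. K t = 0) \<and>
              (\<exists>c\<ge>0. \<forall>\<^sub>F t in sequentially.
                 norm (x (Suc t) - xs) \<le> c * (norm (x t - xs))\<^sup>2)"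
proof -
  interpret pdnm_problem f fi g \<eta> \<beta> m L1 L2
    by unfold_locales (use assms in auto)
  note run = \<open>pdnm_run \<eta> \<beta> f g x y K\<close>
  obtain b where "\<And>z. ereal b \<le> ereal (f z) + g z"
    using assms(6) by (auto simp: F_def)
  with run obtain xs where xs: "subgradient g xs (- gradient f xs)" and lim: "x \<longlonglongrightarrow> xs"
    by (rule pdnm_convergence)
  have full: "\<forall>\<^sub>F t in sequentially. K t = 0"
    using run xs lim by (rule pdnm_eventually_full_step)
  \<comment> \<open>Once \<open>K t = 0\<close>, the next iterate is itself the full-step trial
    point; the quadratic rate has \<open>c = L2 / m\<close>.\<close>
  then have "\<forall>\<^sub>F t in sequentially. norm (x (Suc t) - xs) \<le> L2 / m * (norm (x t - xs))\<^sup>2"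
  proof eventually_elim
    case (elim t)
    then have "x (Suc t) \<in> pdnm_trial \<eta> f g (x t) 0"
      using run by (metis le_refl pdnm_run_def)
    then show ?case
      using xs by (rule full_step_error)
  qed
  moreover have "0 \<le> L2 / m"
    using L2_nonneg m by simp
  ultimately show ?thesis
    using is_arg_min_iff[OF xs] lim full unfolding F_def by blast
qed

end
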